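(* Let $n\ge 1$ and let $a=(a_1,\dots,a_n)$ and $b=(b_1,\dots,b_n)$ be vectors of positive real numbers. Suppose that there is a rearrangement of the components of $a$ and of $b$ (after which the components are again denoted $a_1,\dots,a_n$ and $b_1,\dots,b_n$) such that $$\frac{b_1}{a_1}\ge \frac{b_2}{a_2}\ge\dots\ge\frac{b_n}{a_n}\quad\text{and}\quad a_1b_1\ge a_2b_2\ge\dots\ge a_nb_n .$$ Suppose additionally that one of the following two conditions holds: (a) $e_n(a)\le e_n(b)$ and $e_n(a)\cdot e_n(b)\ge 1$; or (b) $e_n(a)\ge e_n(b)$ and $e_n(a)\cdot e_n(b)\le 1$. Then $$\sum_{i=1}^n(\log a_i)^2\ \le\ \sum_{i=1}^n(\log b_i)^2 .$$
   Context: For $x\in\mathbb{R}^n$, $e_n(x)=x_1x_2\cdots x_n$ denotes the product of all components (the $n$-th elementary symmetric polynomial). $\log$ is the natural logarithm. *)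

theory Defs
  imports Complex_Main "HOL-Combinatorics.Permutations"
begin

text \<open>
  A vector in \<open>\<real>\<^sup>n\<close> is represented by a function \<open>nat \<Rightarrow> real\<close> of which only the values
  at the indices \<open>1, \<dots>, n\<close> matter.
\<close>

definition e :: "nat \<Rightarrow> (nat \<Rightarrow> real) \<Rightarrow> real"
  where "e n x = (\<Prod>i=1..n. x i)"

end

theory Submission imports Defs begin

(* With x = ln b - ln a and y = ln b + ln a, the difference of the two sums of squares is
   the sum of the products x * y. Both sequences are decreasing, so Chebyshev's sum inequality
   bounds n times this sum from below by (sum of x) * (sum of y), which is
   ln (e n b / e n a) * ln (e n a * e n b) and hence nonnegative under either (a) or (b). *)

text \<open>Chebyshev's inequality for similarly ordered sequences, obtained from the oppositely
  ordered case by negating \<open>x\<close>; the indices move from \<open>1..n\<close> to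
  \<open>0..<n\<close>.\<close>

lemma Chebyshev_sum_decreasing:
  fixes x y :: "nat \<Rightarrow> real"
  assumes x: "\<forall>i\<in>{1..<n}. x (i + 1) \<le> x i" and y: "\<forall>i\<in>{1..<n}. y (i + 1) \<le> y i"
  shows "(\<Sum>i=1..n. x i) * (\<Sum>i=1..n. y i) \<le> real n * (\<Sum>i=1..n. x i * y i)"
proof -
  \<comment> \<open>The hypotheses compare only neighbours; induction on \<open>j\<close> extends
    this to arbitrary pairs.\<close>
  have mono: "z (Suc j) \<le> z (Suc i)"
    if "\<forall>i\<in>{1..<n}. z (i + 1) \<le> z i" "i \<le> j" "j < n" for z :: "nat \<Rightarrow> real" and i j
    using that(2,3)
  proof (induction j rule: dec_induct)
    case (step j)
    have "z (Suc (Suc j)) \<le> z (Suc j)"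
      using that(1) step.prems by auto
    with step show ?case by simp
  qed simp
  have shift: "(\<Sum>i=1..n. z i) = (\<Sum>k=0..<n. z (Suc k))" for z :: "nat \<Rightarrow> real"
    using sum.shift_bounds_Suc_ivl[of z 0 n] by (simp add: atLeastLessThanSuc_atLeastAtMost)
  \<comment> \<open>The sequence \<open>- x\<close> is increasing while \<open>y\<close> is
    decreasing, so the product of the sums is an upper bound here; removing the sign reverses the
    inequality.\<close>
  have "real n * (\<Sum>k=0..<n. - x (Suc k) * y (Suc k))
      \<le> (\<Sum>k=0..<n. - x (Suc k)) * (\<Sum>k=0..<n. y (Suc k))"
    by (rule Chebyshev_sum_upper) (use mono[OF x] mono[OF y] in auto)
  then show ?thesis
    by (simp add: shift sum_negf del: One_nat_def)
qed

theorem theorem3p2: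
  fixes n :: nat and a b :: "nat \<Rightarrow> real"
  assumes "n \<ge> 1"
    and "\<forall>i\<in>{1..n}. a i > 0"
    and "\<forall>i\<in>{1..n}. b i > 0"
    and "\<exists>p q. p permutes {1..n} \<and> q permutes {1..n} \<and>
           (\<forall>i\<in>{1..<n}. b (q i) / a (p i) \<ge> b (q (i + 1)) / a (p (i + 1))) \<and>
           (\<forall>i\<in>{1..<n}. a (p i) * b (q i) \<ge> a (p (i + 1)) * b (q (i + 1)))"
    and "(e n a \<le> e n b \<and> e n a * e n b \<ge> 1) \<or>
         (e n a \<ge> e n b \<and> e n a * e n b \<le> 1)"
  shows "(\<Sum>i=1..n. (ln (a i))\<^sup>2) \<le> (\<Sum>i=1..n. (ln (b i))\<^sup>2)"
proof -
  obtain p q where p: "p permutes {1..n}" and q: "q permutes {1..n}"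
    and quot: "\<forall>i\<in>{1..<n}. b (q i) / a (p i) \<ge> b (q (i + 1)) / a (p (i + 1))"
    and mult: "\<forall>i\<in>{1..<n}. a (p i) * b (q i) \<ge> a (p (i + 1)) * b (q (i + 1))"
    using assms(4) by blast
  have ap: "a (p i) > 0" and bq: "b (q i) > 0" if "i \<in> {1..n}" for i
    using assms(2,3) permutes_in_image[OF p] permutes_in_image[OF q] that by auto
  \<comment> \<open>Stated for arbitrary \<open>f\<close> because it serves both \<open>ln\<close>,
    in the sums of \<open>x\<close> and \<open>y\<close>, and its square, in the final sums.\<close>
  have perm_a: "(\<Sum>i=1..n. f (a (p i))) = (\<Sum>i=1..n. f (a i))" for f :: "real \<Rightarrow> real"
    using sum.permute[OF p, of "f \<circ> a"] by (simp add: o_def)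
  have perm_b: "(\<Sum>i=1..n. f (b (q i))) = (\<Sum>i=1..n. f (b i))" for f :: "real \<Rightarrow> real"
    using sum.permute[OF q, of "f \<circ> b"] by (simp add: o_def)
  have pos: "e n a > 0" "e n b > 0"
    using assms(2,3) by (auto simp: e_def intro!: prod_pos)
  have ln_e: "(\<Sum>i=1..n. ln (a i)) = ln (e n a)" "(\<Sum>i=1..n. ln (b i)) = ln (e n b)"
    using assms(2,3) by (auto simp: e_def intro!: ln_prod[symmetric])
  define x where "x i = ln (b (q i)) - ln (a (p i))" for i
  define y where "y i = ln (b (q i)) + ln (a (p i))" for i
  \<comment> \<open>By positivity \<open>x i\<close> is the logarithm of the i-th quotient and
    \<open>y i\<close> that of the i-th product, so monotonicity of \<open>ln\<close> transfers both
    orderings.\<close>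
  have x_dec: "\<forall>i\<in>{1..<n}. x (i + 1) \<le> x i"
  proof
    fix i assume i: "i \<in> {1..<n}"
    then have "ln (b (q (i + 1)) / a (p (i + 1))) \<le> ln (b (q i) / a (p i))"
      using quot ap[of i] bq[of i] ap[of "i + 1"] bq[of "i + 1"] by (intro ln_mono) auto
    then show "x (i + 1) \<le> x i"
      using i ap[of i] bq[of i] ap[of "i + 1"] bq[of "i + 1"] by (simp add: x_def ln_div)
  qed
  have y_dec: "\<forall>i\<in>{1..<n}. y (i + 1) \<le> y i"
  proof
    fix i assume i: "i \<in> {1..<n}"
    then have "ln (a (p (i + 1)) * b (q (i + 1))) \<le> ln (a (p i) * b (q i))"
      using mult ap[of i] bq[of i] ap[of "i + 1"] bq[of "i + 1"] by (intro ln_mono) auto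
    then show "y (i + 1) \<le> y i"
      using i ap[of i] bq[of i] ap[of "i + 1"] bq[of "i + 1"] by (simp add: y_def ln_mult)
  qed
  have sums: "(\<Sum>i=1..n. x i) = ln (e n b) - ln (e n a)"
    "(\<Sum>i=1..n. y i) = ln (e n a * e n b)"
    using pos perm_a[of ln] perm_b[of ln]
    by (simp_all add: x_def y_def sum_subtractf sum.distrib ln_e ln_mult del: One_nat_def)
  \<comment> \<open>Under (a) both factors are nonnegative, under (b) both are nonpositive.\<close>
  have "0 \<le> (ln (e n b) - ln (e n a)) * ln (e n a * e n b)"
    using assms(5) pos by (auto intro: mult_nonneg_nonneg mult_nonpos_nonpos)
  also have "\<dots> \<le> real n * (\<Sum>i=1..n. x i * y i)"
    using Chebyshev_sum_decreasing[OF x_dec y_dec] by (simp only: sums)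
  finally have "0 \<le> (\<Sum>i=1..n. x i * y i)"
    using assms(1) by (simp add: zero_le_mult_iff)
  \<comment> \<open>Each product \<open>x i * y i\<close> is a factored difference of
    squares.\<close>
  also have "\<dots> = (\<Sum>i=1..n. (ln (b (q i)))\<^sup>2 - (ln (a (p i)))\<^sup>2)"
    by (simp add: x_def y_def power2_eq_square algebra_simps)
  also have "\<dots> = (\<Sum>i=1..n. (ln (b i))\<^sup>2) - (\<Sum>i=1..n. (ln (a i))\<^sup>2)"
    using perm_a[of "\<lambda>t. (ln t)\<^sup>2"] perm_b[of "\<lambda>t. (ln t)\<^sup>2"] by (simp add: sum_subtractf)
  finally show ?thesis by simp
qed

end
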